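(* Let $G$ be a torsion-free group with identity element $e$ and let $R$ be a unital $G$-graded ring. If the $G$-grading on $R$ is non-degenerate and $R_e$ is a domain, then the following assertions hold: (i) Every central unit in $R$ is homogeneous; (ii) $R$ has no non-trivial central zero-divisor, i.e. if $x\in Z(R)$ is nonzero and $y\in R$ satisfies $xy=0$, then $y=0$; (iii) $R$ is indecomposable, i.e. every central idempotent in $R$ is trivial.
   Context: Rings are associative, not necessarily commutative. A ring $R$ is $G$-graded if there is a collection $\{R_g\}_{g\in G}$ of additive subgroups of $R$ such that $R=\oplus_{g\in G}R_g$ and $R_gR_h\subseteq R_{gh}$ for all $g,h\in G$. A nonzero element of $R$ is homogeneous if it belongs to $R_g$ for some $g\in G$. The $G$-grading is non-degenerate if, for each $g\in G$ and each nonzero $r_g\in R_g$, we have $r_gR_{g^{-1}}\neq\{0\}$ and $R_{g^{-1}}r_g\neq\{0\}$. A domain is a nonzero (not necessarily commutative) ring in which the product of any two nonzero elements is nonzero. $Z(R)$ denotes the center of $R$. An idempotent is trivial if it equals $0$ or $1_R$. *)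

theory Defs
  imports "HOL-Algebra.Algebra"
begin

definition torsion_free :: "('g, 'm) monoid_scheme \<Rightarrow> bool" where
  "torsion_free G \<longleftrightarrow>
     (\<forall>x\<in>carrier G. \<forall>n>0. x [^]\<^bsub>G\<^esub> (n::nat) = \<one>\<^bsub>G\<^esub> \<longrightarrow> x = \<one>\<^bsub>G\<^esub>)"

text \<open>
  The component in degree \<open>g\<close> is \<open>S g\<close>; only degrees in \<open>carrier G\<close> matter. The direct sum
  condition is the unique decomposition of each element into a finitely supported family of
  components. Families are taken in the extensional function space, so that uniqueness is not
  affected by values outside \<open>carrier G\<close>.
\<close>

locale graded_ring = G: group G + R: ring R
  for G :: "('g, 'm) monoid_scheme" and R :: "('r, 'n) ring_scheme" +
  fixes S :: "'g \<Rightarrow> 'r set"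
  assumes component_subgroup: "g \<in> carrier G \<Longrightarrow> additive_subgroup (S g) R"
    and direct_sum: "x \<in> carrier R \<Longrightarrow>
      \<exists>!f. f \<in> (\<Pi>\<^sub>E g\<in>carrier G. S g) \<and> finite {g \<in> carrier G. f g \<noteq> \<zero>\<^bsub>R\<^esub>} \<and>
           x = finsum R f {g \<in> carrier G. f g \<noteq> \<zero>\<^bsub>R\<^esub>}"
    and component_mult: "\<lbrakk>g \<in> carrier G; h \<in> carrier G\<rbrakk> \<Longrightarrow>
      S g <#>\<^bsub>R\<^esub> S h \<subseteq> S (g \<otimes>\<^bsub>G\<^esub> h)"

text \<open>
  That \<open>\<one>\<close> lies in the component of the identity of \<open>G\<close> is not part of the definition of a
  grading, but follows from it. Hence this component is always a unital ring.
\<close>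

context graded_ring
begin

lemma component_carrier: "g \<in> carrier G \<Longrightarrow> a \<in> S g \<Longrightarrow> a \<in> carrier R"
  using additive_subgroup.a_Hcarr[OF component_subgroup] by blast

lemma ex1_implies_unique: "\<exists>!z. P z \<Longrightarrow> P a \<Longrightarrow> P b \<Longrightarrow> a = b"
  by blast

lemma decomposition_unique:
  assumes f: "f \<in> (\<Pi> g\<in>carrier G. S g)" and A: "finite A" "A \<subseteq> carrier G"
    and f0: "\<And>g. g \<in> carrier G - A \<Longrightarrow> f g = \<zero>\<^bsub>R\<^esub>"
    and f': "f' \<in> (\<Pi> g\<in>carrier G. S g)" and A': "finite A'" "A' \<subseteq> carrier G"
    and f'0: "\<And>g. g \<in> carrier G - A' \<Longrightarrow> f' g = \<zero>\<^bsub>R\<^esub>"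
    and eq: "finsum R f A = finsum R f' A'"
    and h: "h \<in> carrier G"
  shows "f h = f' h"
proof -
  have *: "restrict g (carrier G) \<in> (\<Pi>\<^sub>E g\<in>carrier G. S g) \<and>
      finite {k \<in> carrier G. restrict g (carrier G) k \<noteq> \<zero>\<^bsub>R\<^esub>} \<and>
      finsum R g B = finsum R (restrict g (carrier G))
        {k \<in> carrier G. restrict g (carrier G) k \<noteq> \<zero>\<^bsub>R\<^esub>}"
    if g: "g \<in> (\<Pi> g\<in>carrier G. S g)" and B: "finite B" "B \<subseteq> carrier G"
    and g0: "\<And>k. k \<in> carrier G - B \<Longrightarrow> g k = \<zero>\<^bsub>R\<^esub>" for g B
  proof -
    let ?C = "{k \<in> carrier G. restrict g (carrier G) k \<noteq> \<zero>\<^bsub>R\<^esub>}"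
    have sub: "?C \<subseteq> B" using g0 by auto
    have "finsum R g B = finsum R (restrict g (carrier G)) ?C"
    proof (rule R.add.finprod_mono_neutral_cong_right[OF B(1) sub])
      show "g \<in> B \<rightarrow> carrier R"
        using g B(2) component_carrier by blast
    qed (use B in auto)
    then show ?thesis using g finite_subset[OF sub B(1)] by auto
  qed
  have "finsum R f A \<in> carrier R"
    by (rule R.finsum_closed) (use f A component_carrier in blast)
  note ex = direct_sum[OF this]
  have "restrict f (carrier G) = restrict f' (carrier G)"
  proof (rule ex1_implies_unique[OF ex])
    show "restrict f (carrier G) \<in> (\<Pi>\<^sub>E g\<in>carrier G. S g) \<and>
      finite {k \<in> carrier G. restrict f (carrier G) k \<noteq> \<zero>\<^bsub>R\<^esub>} \<and>
      finsum R f A = finsum R (restrict f (carrier G))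
        {k \<in> carrier G. restrict f (carrier G) k \<noteq> \<zero>\<^bsub>R\<^esub>}"
      by (rule *[OF f A]) (rule f0)
    show "restrict f' (carrier G) \<in> (\<Pi>\<^sub>E g\<in>carrier G. S g) \<and>
      finite {k \<in> carrier G. restrict f' (carrier G) k \<noteq> \<zero>\<^bsub>R\<^esub>} \<and>
      finsum R f A = finsum R (restrict f' (carrier G))
        {k \<in> carrier G. restrict f' (carrier G) k \<noteq> \<zero>\<^bsub>R\<^esub>}"
      unfolding eq by (rule *[OF f' A']) (rule f'0)
  qed
  then show ?thesis using h by (metis restrict_apply')
qed

lemma component_zero: "g \<in> carrier G \<Longrightarrow> \<zero>\<^bsub>R\<^esub> \<in> S g"
  using additive_subgroup.zero_closed[OF component_subgroup] .

lemma component_mult_mem: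
  "\<lbrakk>g \<in> carrier G; h \<in> carrier G; a \<in> S g; b \<in> S h\<rbrakk> \<Longrightarrow> a \<otimes>\<^bsub>R\<^esub> b \<in> S (g \<otimes>\<^bsub>G\<^esub> h)"
  using component_mult[of g h] unfolding set_mult_def by blast

lemma one_in_component_one: "\<one>\<^bsub>R\<^esub> \<in> S \<one>\<^bsub>G\<^esub>"
proof -
  from direct_sum[OF R.one_closed] obtain f where
    f: "f \<in> (\<Pi>\<^sub>E g\<in>carrier G. S g)" and fin: "finite {g \<in> carrier G. f g \<noteq> \<zero>\<^bsub>R\<^esub>}"
    and one: "\<one>\<^bsub>R\<^esub> = finsum R f {g \<in> carrier G. f g \<noteq> \<zero>\<^bsub>R\<^esub>}"
    by blast
  define A where "A = {g \<in> carrier G. f g \<noteq> \<zero>\<^bsub>R\<^esub>}"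
  have A: "finite A" "A \<subseteq> carrier G" and oneA: "\<one>\<^bsub>R\<^esub> = finsum R f A"
    using fin one by (auto simp: A_def)
  have fS: "f g \<in> S g" if "g \<in> carrier G" for g using f that by auto
  have fR: "f g \<in> carrier R" if "g \<in> carrier G" for g
    using component_carrier[OF that fS[OF that]] .
  let ?e = "f \<one>\<^bsub>G\<^esub>"
  have unit: "?e \<otimes>\<^bsub>R\<^esub> x = x" if h: "h \<in> carrier G" and x: "x \<in> S h" for h x
  proof -
    have xR: "x \<in> carrier R" using component_carrier[OF h x] .
    let ?F = "\<lambda>k. f (k \<otimes>\<^bsub>G\<^esub> inv\<^bsub>G\<^esub> h) \<otimes>\<^bsub>R\<^esub> x"
    let ?B = "(\<lambda>k. k \<otimes>\<^bsub>G\<^esub> h) ` A"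
    have canc: "k \<otimes>\<^bsub>G\<^esub> h \<otimes>\<^bsub>G\<^esub> inv\<^bsub>G\<^esub> h = k" "k \<otimes>\<^bsub>G\<^esub> inv\<^bsub>G\<^esub> h \<otimes>\<^bsub>G\<^esub> h = k"
      if "k \<in> carrier G" for k
      using h that by (simp_all add: G.m_assoc)
    have FS: "?F k \<in> S k" if k: "k \<in> carrier G" for k
      using component_mult_mem[of "k \<otimes>\<^bsub>G\<^esub> inv\<^bsub>G\<^esub> h" h] fS h x k canc(2)[OF k]
      by (metis G.inv_closed G.m_closed)
    have B: "finite ?B" "?B \<subseteq> carrier G" using A h by auto
    have F0: "?F k = \<zero>\<^bsub>R\<^esub>" if k: "k \<in> carrier G - ?B" for k
    proof -
      have "k \<otimes>\<^bsub>G\<^esub> inv\<^bsub>G\<^esub> h \<notin> A"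
        using k canc(2)[of k] by (metis DiffD1 DiffD2 image_eqI)
      then have "f (k \<otimes>\<^bsub>G\<^esub> inv\<^bsub>G\<^esub> h) = \<zero>\<^bsub>R\<^esub>"
        using k h by (auto simp: A_def)
      then show ?thesis using xR by simp
    qed
    have inj: "inj_on (\<lambda>k. k \<otimes>\<^bsub>G\<^esub> h) A"
      using A h by (auto simp: inj_on_def subset_eq)
    have "finsum R ?F ?B = finsum R (\<lambda>k. ?F (k \<otimes>\<^bsub>G\<^esub> h)) A"
      by (rule R.add.finprod_reindex[OF _ inj]) (use FS B component_carrier in blast)
    also have "\<dots> = finsum R (\<lambda>k. f k \<otimes>\<^bsub>R\<^esub> x) A"
    proof (rule R.finsum_cong'[OF refl])
      show "(\<lambda>k. f k \<otimes>\<^bsub>R\<^esub> x) \<in> A \<rightarrow> carrier R" using fR xR A by auto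
      show "f (k \<otimes>\<^bsub>G\<^esub> h \<otimes>\<^bsub>G\<^esub> inv\<^bsub>G\<^esub> h) \<otimes>\<^bsub>R\<^esub> x = f k \<otimes>\<^bsub>R\<^esub> x" if "k \<in> A" for k
        using canc(1) that A by auto
    qed
    also have "\<dots> = \<one>\<^bsub>R\<^esub> \<otimes>\<^bsub>R\<^esub> x"
      unfolding oneA by (rule R.finsum_ldistr[symmetric]) (use A xR fR in auto)
    also have "\<dots> = finsum R (\<lambda>k. if k = h then x else \<zero>\<^bsub>R\<^esub>) {h}"
      using xR by simp
    finally have sums: "finsum R ?F ?B = finsum R (\<lambda>k. if k = h then x else \<zero>\<^bsub>R\<^esub>) {h}" .
    have "?F h = (if h = h then x else \<zero>\<^bsub>R\<^esub>)"
      by (rule decomposition_unique[OF _ B F0 _ _ _ _ sums h])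
        (use FS h x component_zero in auto)
    then show ?thesis using h by simp
  qed
  have e: "?e \<in> carrier R" using fR by simp
  have "?e = ?e \<otimes>\<^bsub>R\<^esub> finsum R f A" using oneA e by (metis R.r_one)
  also have "\<dots> = finsum R (\<lambda>k. ?e \<otimes>\<^bsub>R\<^esub> f k) A"
    by (rule R.finsum_rdistr) (use A e fR in auto)
  also have "\<dots> = finsum R f A"
    by (rule R.finsum_cong'[OF refl]) (use A fR fS unit in auto)
  finally have "?e = \<one>\<^bsub>R\<^esub>" using oneA by simp
  then show ?thesis using fS[of "\<one>\<^bsub>G\<^esub>"] by simp
qed

lemma ring_component_one: "ring (R\<lparr>carrier := S \<one>\<^bsub>G\<^esub>\<rparr>)"
proof (rule R.subring_is_ring, rule subring.intro)
  show "subgroup (S \<one>\<^bsub>G\<^esub>) (add_monoid R)"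
    using additive_subgroup.a_subgroup[OF component_subgroup[OF G.one_closed]] .
  show "submonoid (S \<one>\<^bsub>G\<^esub>) R"
    by standard (use component_carrier one_in_component_one
        component_mult_mem[of "\<one>\<^bsub>G\<^esub>" "\<one>\<^bsub>G\<^esub>"] in auto)
qed

end

definition nondegenerate_grading ::
    "('g, 'm) monoid_scheme \<Rightarrow> ('r, 'n) ring_scheme \<Rightarrow> ('g \<Rightarrow> 'r set) \<Rightarrow> bool" where
  "nondegenerate_grading G R S \<longleftrightarrow>
     (\<forall>g\<in>carrier G. \<forall>r\<in>S g. r \<noteq> \<zero>\<^bsub>R\<^esub> \<longrightarrow>
        r <#\<^bsub>R\<^esub> S (inv\<^bsub>G\<^esub> g) \<noteq> {\<zero>\<^bsub>R\<^esub>} \<and>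
        S (inv\<^bsub>G\<^esub> g) #>\<^bsub>R\<^esub> r \<noteq> {\<zero>\<^bsub>R\<^esub>})"

definition homogeneous ::
    "('g, 'm) monoid_scheme \<Rightarrow> ('r, 'n) ring_scheme \<Rightarrow> ('g \<Rightarrow> 'r set) \<Rightarrow> 'r \<Rightarrow> bool" where
  "homogeneous G R S x \<longleftrightarrow> x \<noteq> \<zero>\<^bsub>R\<^esub> \<and> (\<exists>g\<in>carrier G. x \<in> S g)"

text \<open>The library locale \<open>domain\<close> assumes commutativity, which is not wanted here.\<close>

definition noncomm_domain :: "('r, 'n) ring_scheme \<Rightarrow> bool" where
  "noncomm_domain R \<longleftrightarrow> ring R \<and> carrier R \<noteq> {\<zero>\<^bsub>R\<^esub>} \<and>
     (\<forall>a\<in>carrier R. \<forall>b\<in>carrier R. a \<noteq> \<zero>\<^bsub>R\<^esub> \<longrightarrow> b \<noteq> \<zero>\<^bsub>R\<^esub> \<longrightarrow> a \<otimes>\<^bsub>R\<^esub> b \<noteq> \<zero>\<^bsub>R\<^esub>)"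

definition ring_center :: "('r, 'n) ring_scheme \<Rightarrow> 'r set" where
  "ring_center R = {x \<in> carrier R. \<forall>y\<in>carrier R. x \<otimes>\<^bsub>R\<^esub> y = y \<otimes>\<^bsub>R\<^esub> x}"

end

theory Submission
  imports Defs
begin

text \<open>
  Two homogeneous elements \<open>a\<close>, \<open>b\<close> that are non-zero have a non-zero product: by non-degeneracy
  there are homogeneous \<open>c\<close>, \<open>d\<close> with \<open>c a\<close> and \<open>b d\<close> non-zero in the domain \<open>R\<^sub>e\<close>, so
  \<open>c a b d \<noteq> 0\<close>. Consequently the degrees \<open>g\<close> with \<open>R\<^sub>g \<noteq> 0\<close> form a subgroup \<open>H\<close>, and for a central
  element \<open>x\<close> the relation \<open>r x = x r\<close>, with \<open>r\<close> homogeneous of degree \<open>h \<in> H\<close>, shows that the finite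
  set of degrees occurring in \<open>x\<close> is invariant under conjugation by \<open>h\<close>.

  The theorem is thus about a finite conjugation-invariant subset \<open>A\<close> of the torsion-free group \<open>H\<close>.
  The subgroup \<open>K\<close> generated by \<open>A\<close> acts on \<open>A\<close> by conjugation, the kernel of this action is the
  centre of \<open>K\<close>, and so the centre has finite index. The transfer homomorphism from \<open>K\<close> to
  its centre then shows that commutators of \<open>K\<close> are torsion, hence trivial
  (\<open>finite_conjugation_closed_commute\<close>). A torsion-free abelian group admits a translation-invariant
  linear order, and the products of the two maxima and of the two minima of finite sets \<open>A\<close>, \<open>B\<close> are
  each attained only once (\<open>torsion_free_two_unique_products\<close>).

  Let now \<open>y \<noteq> 0\<close> be arbitrary, pick a degree \<open>t\<close> occurring in \<open>y\<close>, and apply this to \<open>A\<close> and to the set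
  \<open>B\<close> of all \<open>k \<in> K\<close> such that \<open>k t\<close> occurs in \<open>y\<close>. Both extreme products survive in \<open>x y\<close>, and they have
  different degrees unless \<open>x\<close> is homogeneous (\<open>center_mult_two_unique_degrees\<close>). Hence \<open>x y \<noteq> 0\<close>,
  and if \<open>x y = 1\<close>, which has the single degree \<open>e\<close>, then \<open>x\<close> is homogeneous. Idempotents are covered
  by \<open>p (1 - p) = 0\<close>.
\<close>

section \<open>Torsion-free groups with finite conjugacy classes\<close>

lemma (in group) inv_cancel_left:
  assumes "x \<in> carrier G" and "y \<in> carrier G"
  shows "inv x \<otimes> (x \<otimes> y) = y" and "x \<otimes> (inv x \<otimes> y) = y"
  using assms by (simp_all add: m_assoc[symmetric])

text \<open>
  The transfer into a central subgroup. Choose representatives \<open>t W\<close> of the cosets; then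
  \<open>t W x = d W x \<cdot> t (W x)\<close> with \<open>d W x \<in> Z\<close>. The cocycle identity \<open>d W (x y) = d W x \<cdot> d (W x) y\<close>,
  multiplied over all cosets, makes \<open>x \<mapsto> \<Prod> d W x\<close> a homomorphism, because \<open>W \<mapsto> W x\<close> permutes the cosets.
  For \<open>x \<in> Z\<close> every factor equals \<open>x\<close>.
\<close>

lemma (in group) exists_transfer_hom:
  assumes Z: "subgroup Z G"
    and central: "\<And>z x. z \<in> Z \<Longrightarrow> x \<in> carrier G \<Longrightarrow> z \<otimes> x = x \<otimes> z"
    and fin: "finite (rcosets Z)"
  shows "\<exists>V \<in> hom G (G\<lparr>carrier := Z\<rparr>). \<forall>z\<in>Z. V z = z [^] card (rcosets Z)"
proof -
  interpret Z: subgroup Z G by fact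
  interpret ZG: group "G\<lparr>carrier := Z\<rparr>" by (rule Z.subgroup_is_group[OF is_group])
  interpret ZG: comm_group "G\<lparr>carrier := Z\<rparr>"
    by (rule ZG.group_comm_groupI) (use central in auto)
  define t where "t W = (SOME w. w \<in> W)" for W :: "'a set"
  define d where "d W x = t W \<otimes> x \<otimes> inv t (W #> x)" for W x
  have t: "t W \<in> W" if "W \<in> rcosets Z" for W
    unfolding t_def using Z.rcosets_non_empty[OF that] by (simp add: some_in_eq)
  have WG: "W \<subseteq> carrier G" if "W \<in> rcosets Z" for W
    using that Z.rcosets_carrier[OF is_group] by auto
  have tG: "t W \<in> carrier G" if "W \<in> rcosets Z" for W using t[OF that] WG[OF that] by auto
  have act: "W #> x \<in> rcosets Z" if W: "W \<in> rcosets Z" and x: "x \<in> carrier G" for W x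
    using W x by (auto simp: RCOSETS_def coset_mult_assoc Z.subset)
  have act_assoc: "W #> x #> y = W #> (x \<otimes> y)"
    if "W \<in> rcosets Z" "x \<in> carrier G" "y \<in> carrier G" for W x y
    using WG[OF that(1)] that(2,3) by (rule coset_mult_assoc)
  have quot: "a \<otimes> inv b \<in> Z" if W: "W \<in> rcosets Z" and ab: "a \<in> W" "b \<in> W" for W a b
  proof -
    obtain c where c: "c \<in> carrier G" "W = Z #> c" using W by (auto simp: RCOSETS_def)
    obtain y z where "y \<in> Z" "z \<in> Z" "a = y \<otimes> c" "b = z \<otimes> c"
      using ab unfolding c by (auto simp: r_coset_def)
    moreover from this c have "a \<otimes> inv b = y \<otimes> inv z"
      by (simp add: inv_mult_group m_assoc inv_cancel_left)
    ultimately show ?thesis by simp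
  qed
  have dZ: "d W x \<in> Z" if W: "W \<in> rcosets Z" and x: "x \<in> carrier G" for W x
    unfolding d_def
  proof (rule quot[OF act[OF W x]])
    show "t W \<otimes> x \<in> W #> x" using t[OF W] by (auto simp: r_coset_def)
  qed (rule t[OF act[OF W x]])
  have d_mult: "d W (x \<otimes> y) = d W x \<otimes> d (W #> x) y"
    if W: "W \<in> rcosets Z" and x: "x \<in> carrier G" and y: "y \<in> carrier G" for W x y
  proof -
    let ?a = "t W" and ?b = "t (W #> x)" and ?c = "t (W #> (x \<otimes> y))"
    have cl: "?a \<in> carrier G" "?b \<in> carrier G" "?c \<in> carrier G"
      using W x y by (auto intro!: tG act)
    have "d W x \<otimes> d (W #> x) y = (?a \<otimes> x \<otimes> inv ?b) \<otimes> (?b \<otimes> y \<otimes> inv ?c)"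
      using act_assoc[OF W x y] by (simp add: d_def)
    also have "\<dots> = ?a \<otimes> x \<otimes> (inv ?b \<otimes> ?b) \<otimes> y \<otimes> inv ?c"
      using cl x y by (simp add: m_assoc inv_cancel_left)
    finally show ?thesis using cl x y by (simp add: d_def m_assoc inv_cancel_left)
  qed
  define V where "V x = finprod (G\<lparr>carrier := Z\<rparr>) (\<lambda>W. d W x) (rcosets Z)" for x
  have "V \<in> hom G (G\<lparr>carrier := Z\<rparr>)"
  proof (rule homI)
    fix x assume x: "x \<in> carrier G"
    show "V x \<in> carrier (G\<lparr>carrier := Z\<rparr>)"
      unfolding V_def by (rule ZG.finprod_closed) (use dZ x in auto)
  next
    fix x y assume x: "x \<in> carrier G" and y: "y \<in> carrier G"
    have inj: "inj_on (\<lambda>W. W #> x) (rcosets Z)"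
    proof (rule inj_onI)
      fix W W' assume W: "W \<in> rcosets Z" "W' \<in> rcosets Z" and eq: "W #> x = W' #> x"
      have "W #> x #> inv x = W' #> x #> inv x" using eq by simp
      then show "W = W'" using W x WG by (simp add: act_assoc)
    qed
    have img: "(\<lambda>W. W #> x) ` (rcosets Z) = rcosets Z"
      by (rule endo_inj_surj[OF fin _ inj]) (use act x in auto)
    have "V (x \<otimes> y) = finprod (G\<lparr>carrier := Z\<rparr>)
        (\<lambda>W. d W x \<otimes>\<^bsub>G\<lparr>carrier := Z\<rparr>\<^esub> d (W #> x) y) (rcosets Z)"
      unfolding V_def
      by (rule ZG.finprod_cong') (use dZ act d_mult x y in auto)
    also have "\<dots> = V x \<otimes>\<^bsub>G\<lparr>carrier := Z\<rparr>\<^esub>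
        finprod (G\<lparr>carrier := Z\<rparr>) (\<lambda>W. d (W #> x) y) (rcosets Z)"
      unfolding V_def by (rule ZG.finprod_multf) (use dZ act x y in auto)
    also have "finprod (G\<lparr>carrier := Z\<rparr>) (\<lambda>W. d (W #> x) y) (rcosets Z) =
        finprod (G\<lparr>carrier := Z\<rparr>) (\<lambda>W. d W y) ((\<lambda>W. W #> x) ` (rcosets Z))"
      by (rule ZG.finprod_reindex[symmetric, OF _ inj]) (use dZ act x y in auto)
    finally show "V (x \<otimes> y) = V x \<otimes>\<^bsub>G\<lparr>carrier := Z\<rparr>\<^esub> V y"
      unfolding img by (simp add: V_def)
  qed
  moreover have "V z = z [^] card (rcosets Z)" if z: "z \<in> Z" for z
  proof -
    have "d W z = z" if W: "W \<in> rcosets Z" for W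
    proof -
      obtain c where c: "c \<in> carrier G" "W = Z #> c" using W by (auto simp: RCOSETS_def)
      have "W #> z = Z #> (z \<otimes> c)"
        using c z by (simp add: coset_mult_assoc Z.subset central Z.mem_carrier)
      also have "\<dots> = W"
        using c z by (simp add: coset_mult_assoc[symmetric] Z.subset Z.mem_carrier coset_join2[OF _ Z])
      finally show ?thesis
        using tG[OF W] z by (simp add: d_def central[OF z, symmetric] m_assoc Z.mem_carrier)
    qed
    then have "V z = finprod (G\<lparr>carrier := Z\<rparr>) (\<lambda>W. z) (rcosets Z)"
      unfolding V_def by (intro ZG.finprod_cong') (use z in auto)
    also have "\<dots> = z [^] card (rcosets Z)"
      using ZG.finprod_const[of z] z by (simp add: nat_pow_consistent[symmetric])
    finally show ?thesis .
  qed
  ultimately show ?thesis by blast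
qed

text \<open>
  The transfer maps a commutator \<open>c\<close> to \<open>\<one>\<close>, as its target is abelian. Some positive power of \<open>c\<close> lies in
  the central subgroup, where the transfer is a power map; hence \<open>c\<close> is torsion.
\<close>

lemma (in group) torsion_free_commute_if_central_finite_index:
  assumes tf: "torsion_free G" and Z: "subgroup Z G"
    and central: "\<And>z x. z \<in> Z \<Longrightarrow> x \<in> carrier G \<Longrightarrow> z \<otimes> x = x \<otimes> z"
    and fin: "finite (rcosets Z)"
    and x: "x \<in> carrier G" and y: "y \<in> carrier G"
  shows "x \<otimes> y = y \<otimes> x"
proof -
  interpret Z: subgroup Z G by fact
  interpret ZG: group "G\<lparr>carrier := Z\<rparr>" by (rule Z.subgroup_is_group[OF is_group])
  interpret ZG: comm_group "G\<lparr>carrier := Z\<rparr>"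
    by (rule ZG.group_comm_groupI) (use central in auto)
  obtain V where V: "V \<in> hom G (G\<lparr>carrier := Z\<rparr>)"
    and VZ: "\<And>z. z \<in> Z \<Longrightarrow> V z = z [^] card (rcosets Z)"
    using exists_transfer_hom[OF Z central fin] by blast
  interpret V: group_hom G "G\<lparr>carrier := Z\<rparr>" V by standard (rule V)
  let ?c = "x \<otimes> y \<otimes> inv (y \<otimes> x)"
  have c: "?c \<in> carrier G" using x y by simp
  have "V ?c = V x \<otimes>\<^bsub>G\<lparr>carrier := Z\<rparr>\<^esub> V y \<otimes>\<^bsub>G\<lparr>carrier := Z\<rparr>\<^esub>
      inv\<^bsub>G\<lparr>carrier := Z\<rparr>\<^esub> (V y \<otimes>\<^bsub>G\<lparr>carrier := Z\<rparr>\<^esub> V x)"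
    using V.hom_mult[of "x \<otimes> y" "inv (y \<otimes> x)"] V.hom_inv[of "y \<otimes> x"]
      V.hom_mult[of x y] V.hom_mult[of y x] x y by (simp only: m_closed inv_closed)
  also have "V y \<otimes>\<^bsub>G\<lparr>carrier := Z\<rparr>\<^esub> V x = V x \<otimes>\<^bsub>G\<lparr>carrier := Z\<rparr>\<^esub> V y"
    using V.hom_closed[OF x] V.hom_closed[OF y] by (rule ZG.m_comm[rotated])
  finally have Vc: "V ?c = \<one>\<^bsub>G\<lparr>carrier := Z\<rparr>\<^esub>" using x y by (simp only: V.hom_closed ZG.r_inv ZG.m_closed)
  have "\<not> inj_on (\<lambda>n::nat. Z #> (?c [^] n)) UNIV"
  proof
    assume "inj_on (\<lambda>n::nat. Z #> (?c [^] n)) UNIV"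
    moreover have "range (\<lambda>n::nat. Z #> (?c [^] n)) \<subseteq> rcosets Z"
      using c by (auto simp: RCOSETS_def)
    ultimately show False using fin finite_imageD finite_subset infinite_UNIV_nat by metis
  qed
  then obtain i j :: nat where ij: "i < j" "Z #> (?c [^] i) = Z #> (?c [^] j)"
    unfolding inj_on_def by (metis nat_neq_iff)
  have "?c [^] j \<in> Z #> (?c [^] i)" unfolding ij(2) using rcos_self[OF nat_pow_closed[OF c] Z] .
  then obtain z where z: "z \<in> Z" "?c [^] j = z \<otimes> ?c [^] i" by (auto simp: r_coset_def)
  have "?c [^] (j - i) \<otimes> ?c [^] i = z \<otimes> ?c [^] i"
    using ij z c by (simp only: nat_pow_mult) simp
  then have "?c [^] (j - i) \<in> Z" using z c by (metis nat_pow_closed right_cancel Z.mem_carrier)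
  then have "(?c [^] (j - i)) [^] card (rcosets Z) = V (?c [^] (j - i))" using VZ by simp
  also have "\<dots> = \<one>" using V.hom_nat_pow[OF c, of "j - i"] Vc by (simp add: nat_pow_consistent[symmetric])
  finally have "?c [^] ((j - i) * card (rcosets Z)) = \<one>" using c by (simp only: nat_pow_pow)
  moreover have "card (rcosets Z) > 0"
    using fin Z.subgroup_in_rcosets[OF is_group] by (auto simp: card_gt_0_iff)
  ultimately have "?c = \<one>"
    using tf[unfolded torsion_free_def, rule_format, OF c, of "(j - i) * card (rcosets Z)"] ij(1)
    by simp
  then show ?thesis using inv_solve_right[of \<one> "x \<otimes> y" "y \<otimes> x"] x y by simp
qed

lemma torsion_free_subgroup:
  assumes "group G" and "subgroup K G" and "torsion_free G"
  shows "torsion_free (G\<lparr>carrier := K\<rparr>)"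
  using assms(3) subgroup.mem_carrier[OF assms(2)]
    monoid.nat_pow_consistent[OF group.is_monoid[OF assms(1)], of _ _ K]
  unfolding torsion_free_def by auto

text \<open>
  The conjugation action of \<open>K = generate G A\<close> on the finite set \<open>A\<close> has finitely many
  values, so its kernel has finite index in \<open>K\<close>; the kernel centralises the generators of \<open>K\<close>, hence \<open>K\<close>.
\<close>

lemma (in group) finite_conjugation_closed_commute:
  assumes tf: "torsion_free G" and fin: "finite A" and A: "A \<subseteq> carrier G"
    and conj: "\<And>g a. g \<in> carrier G \<Longrightarrow> a \<in> A \<Longrightarrow> inv g \<otimes> a \<otimes> g \<in> A"
    and a: "a \<in> generate G A" and b: "b \<in> generate G A"
  shows "a \<otimes> b = b \<otimes> a"
proof -
  define K where "K = generate G A"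
  have K: "subgroup K G" unfolding K_def by (rule generate_is_subgroup[OF A])
  interpret K: subgroup K G by fact
  interpret KG: group "G\<lparr>carrier := K\<rparr>" by (rule K.subgroup_is_group[OF is_group])
  have centralizer: "subgroup {g \<in> carrier G. \<forall>b\<in>B. g \<otimes> b = b \<otimes> g} G" if B: "B \<subseteq> carrier G" for B
  proof (rule subgroupI)
    fix g assume g: "g \<in> {g \<in> carrier G. \<forall>b\<in>B. g \<otimes> b = b \<otimes> g}"
    have "inv g \<otimes> b = b \<otimes> inv g" if "b \<in> B" for b
    proof -
      have "b \<in> carrier G" "g \<in> carrier G" "g \<otimes> b = b \<otimes> g" using g that B by auto
      then have "inv g \<otimes> b = inv g \<otimes> (b \<otimes> g) \<otimes> inv g" by (simp add: m_assoc)
      also have "\<dots> = inv g \<otimes> (g \<otimes> b) \<otimes> inv g" using \<open>g \<otimes> b = b \<otimes> g\<close> by simp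
      also have "\<dots> = b \<otimes> inv g"
        using \<open>b \<in> carrier G\<close> \<open>g \<in> carrier G\<close> by (simp add: m_assoc[symmetric])
      finally show ?thesis .
    qed
    then show "inv g \<in> {g \<in> carrier G. \<forall>b\<in>B. g \<otimes> b = b \<otimes> g}" using g by auto
  next
    fix g h assume g: "g \<in> {g \<in> carrier G. \<forall>b\<in>B. g \<otimes> b = b \<otimes> g}"
      and h: "h \<in> {g \<in> carrier G. \<forall>b\<in>B. g \<otimes> b = b \<otimes> g}"
    have "g \<otimes> h \<otimes> b = b \<otimes> (g \<otimes> h)" if "b \<in> B" for b
    proof -
      have cl: "b \<in> carrier G" "g \<in> carrier G" "h \<in> carrier G"
        and eq: "g \<otimes> b = b \<otimes> g" "h \<otimes> b = b \<otimes> h" using g h that B by auto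
      have "g \<otimes> h \<otimes> b = g \<otimes> b \<otimes> h" using cl eq(2) by (simp add: m_assoc)
      also have "\<dots> = b \<otimes> (g \<otimes> h)" unfolding eq(1) using cl by (simp add: m_assoc)
      finally show ?thesis .
    qed
    then show "g \<otimes> h \<in> {g \<in> carrier G. \<forall>b\<in>B. g \<otimes> b = b \<otimes> g}" using g h by auto
  next
    have "\<one> \<in> {g \<in> carrier G. \<forall>b\<in>B. g \<otimes> b = b \<otimes> g}" using B by auto
    then show "{g \<in> carrier G. \<forall>b\<in>B. g \<otimes> b = b \<otimes> g} \<noteq> {}" by blast
  qed auto
  define Z where "Z = {g \<in> carrier G. \<forall>b\<in>A. g \<otimes> b = b \<otimes> g} \<inter> K"
  have "subgroup Z G" unfolding Z_def by (rule subgroups_Inter_pair[OF centralizer[OF A] K])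
  then have Z: "subgroup Z (G\<lparr>carrier := K\<rparr>)"
    by (rule subgroup_incl[OF _ K]) (auto simp: Z_def)
  have central: "z \<otimes> k = k \<otimes> z" if z: "z \<in> Z" and k: "k \<in> K" for z k
  proof -
    have "K \<subseteq> {g \<in> carrier G. \<forall>b\<in>{z}. g \<otimes> b = b \<otimes> g}"
      unfolding K_def
      by (rule generate_subgroup_incl[OF _ centralizer]) (use A z in \<open>auto simp: Z_def\<close>)
    then show ?thesis using k by auto
  qed
  \<comment> \<open>The permutation of \<open>A\<close> given by \<open>k\<close>; it determines the coset \<open>Z k\<close>.\<close>
  define p where "p k = restrict (\<lambda>b. inv k \<otimes> b \<otimes> k) A" for k
  have same: "Z #> k = Z #> l" if k: "k \<in> K" and l: "l \<in> K" and eq: "p k = p l" for k l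
  proof -
    have "l \<otimes> inv k \<in> Z"
    proof -
      have "l \<otimes> inv k \<otimes> b = b \<otimes> (l \<otimes> inv k)" if b: "b \<in> A" for b
      proof -
        have cl: "b \<in> carrier G" "k \<in> carrier G" "l \<in> carrier G" using A b k l by auto
        have "inv k \<otimes> b \<otimes> k = inv l \<otimes> b \<otimes> l" using fun_cong[OF eq, of b] b by (simp add: p_def)
        then have "l \<otimes> (inv k \<otimes> b \<otimes> k) \<otimes> inv k = l \<otimes> (inv l \<otimes> b \<otimes> l) \<otimes> inv k" by simp
        then show ?thesis using cl by (simp add: m_assoc inv_cancel_left)
      qed
      then show ?thesis using k l by (auto simp: Z_def)
    qed
    then have "Z #> (l \<otimes> inv k) = Z"
      by (intro coset_join2[OF _ \<open>subgroup Z G\<close>]) (use k l in auto)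
    then have "Z #> k = Z #> (l \<otimes> inv k) #> k" by simp
    also have "\<dots> = Z #> l"
      using k l by (subst coset_mult_assoc) (auto simp: Z_def m_assoc)
    finally show ?thesis .
  qed
  have "rcosets\<^bsub>G\<lparr>carrier := K\<rparr>\<^esub> Z = (\<lambda>k. Z #> k) ` K" by (auto simp: RCOSETS_def)
  also have "\<dots> = (\<lambda>q. Z #> inv_into K p q) ` (p ` K)"
    unfolding image_image
    by (rule image_cong[OF refl], rule same)
      (auto intro: inv_into_into simp: f_inv_into_f)
  also have "finite \<dots>"
  proof -
    have "p ` K \<subseteq> A \<rightarrow>\<^sub>E A" unfolding p_def by (auto intro!: conj)
    then show ?thesis using fin by (meson finite_PiE finite_imageI finite_subset)
  qed
  finally have finZ: "finite (rcosets\<^bsub>G\<lparr>carrier := K\<rparr>\<^esub> Z)" .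
  have "a \<otimes>\<^bsub>G\<lparr>carrier := K\<rparr>\<^esub> b = b \<otimes>\<^bsub>G\<lparr>carrier := K\<rparr>\<^esub> a"
    by (rule KG.torsion_free_commute_if_central_finite_index
        [OF torsion_free_subgroup[OF is_group K tf] Z _ finZ])
      (use a b central in \<open>auto simp: K_def[symmetric]\<close>)
  then show ?thesis by simp
qed

section \<open>Ordering torsion-free abelian groups\<close>

text \<open>
  The elements \<open>x \<ge> \<one>\<close> for a translation-invariant partial order on an abelian group, where
  \<open>a \<ge> c\<close> means \<open>a \<otimes> inv c \<in> P\<close>. The order is linear iff every \<open>x\<close> or its inverse lies in the cone.
\<close>

definition positive_cone :: "('g, 'm) monoid_scheme \<Rightarrow> 'g set \<Rightarrow> bool" where
  "positive_cone G P \<longleftrightarrow> submonoid P G \<and> (\<forall>x\<in>P. inv\<^bsub>G\<^esub> x \<in> P \<longrightarrow> x = \<one>\<^bsub>G\<^esub>)"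

text \<open>
  If \<open>p x\<^sup>n\<close> and \<open>q x\<^sup>m\<close> are inverse to each other, then the inverse \<open>p q\<close> of \<open>x\<^bsup>n+m\<^esup>\<close> lies in \<open>P\<close>. The assumption
  forces \<open>n = m = 0\<close>, so that both elements were in \<open>P\<close> already.
\<close>

lemma (in comm_group) positive_cone_adjoin:
  assumes P: "positive_cone G P" and x: "x \<in> carrier G"
    and no: "\<And>n::nat. n > 0 \<Longrightarrow> inv (x [^] n) \<notin> P"
  shows "positive_cone G {p \<otimes> x [^] n |p n. p \<in> P \<and> n \<in> (UNIV :: nat set)}" (is "positive_cone G ?Q")
proof -
  interpret P: submonoid P G using P by (simp add: positive_cone_def)
  have PG: "p \<in> carrier G" if "p \<in> P" for p using that P.subset by auto
  have prod: "(p \<otimes> x [^] n) \<otimes> (q \<otimes> x [^] m) = (p \<otimes> q) \<otimes> x [^] (n + m)"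
    if "p \<in> P" "q \<in> P" for p q and n m :: nat
    using PG[OF that(1)] PG[OF that(2)] x by (simp add: nat_pow_mult[symmetric] m_ac)
  have QI: "p \<otimes> x [^] n \<in> ?Q" if "p \<in> P" for p and n :: nat using that by blast
  have "submonoid ?Q G"
  proof
    show "?Q \<subseteq> carrier G" using PG x by auto
  next
    fix a b assume "a \<in> ?Q" "b \<in> ?Q"
    then obtain p q and n m :: nat where
      "p \<in> P" "q \<in> P" "a = p \<otimes> x [^] n" "b = q \<otimes> x [^] m" by blast
    then show "a \<otimes> b \<in> ?Q" using QI[OF P.m_closed] prod by simp
  next
    show "\<one> \<in> ?Q" using QI[OF P.one_closed, of 0] by simp
  qed
  moreover have "a = \<one>" if aQ: "a \<in> ?Q" "inv a \<in> ?Q" for a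
  proof -
    obtain p q and n m :: nat where
      pq: "p \<in> P" "q \<in> P" "a = p \<otimes> x [^] n" "inv a = q \<otimes> x [^] m" using aQ by blast
    have aG: "a \<in> carrier G" using pq PG x by simp
    then have "(p \<otimes> q) \<otimes> x [^] (n + m) = \<one>"
      using prod[OF pq(1,2), of n m] pq(3,4) r_inv[OF aG] by simp
    then have "inv (x [^] (n + m)) = p \<otimes> q"
      using PG[OF pq(1)] PG[OF pq(2)] x by (intro inv_equality) auto
    then have "\<not> n + m > 0" using no[of "n + m"] P.m_closed[OF pq(1,2)] by metis
    then have "a = p" "inv a = q" using pq PG by auto
    then show "a = \<one>" using P pq(1,2) by (auto simp: positive_cone_def)
  qed
  ultimately show ?thesis by (auto simp: positive_cone_def)
qed

text \<open>
  A maximal cone exists by Zorn's lemma. If it contained neither \<open>x\<close> nor \<open>inv x\<close>, then neither could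
  be adjoined, so that some \<open>x\<^bsup>-n\<^esup>\<close> and some \<open>x\<^sup>m\<close> with \<open>n, m > 0\<close> would be positive. Then \<open>x\<^bsup>nm\<^esup>\<close> and its
  inverse would both be positive, making \<open>x\<close> a torsion element.
\<close>

lemma (in comm_group) torsion_free_total_positive_cone:
  assumes tf: "torsion_free G"
  shows "\<exists>P. positive_cone G P \<and> (\<forall>x\<in>carrier G. x \<in> P \<or> inv x \<in> P)"
proof -
  have "\<exists>P\<in>Collect (positive_cone G). \<forall>Q\<in>Collect (positive_cone G). P \<subseteq> Q \<longrightarrow> Q = P"
  proof (rule subset_Zorn_nonempty)
    have "positive_cone G {\<one>}"
      unfolding positive_cone_def by (auto intro!: submonoid.intro)
    then show "Collect (positive_cone G) \<noteq> {}" by auto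
  next
    fix C assume C: "C \<noteq> {}" "subset.chain (Collect (positive_cone G)) C"
    then have cone: "positive_cone G P" if "P \<in> C" for P
      using that by (auto simp: subset_chain_def)
    have two: "\<exists>P\<in>C. x \<in> P \<and> y \<in> P" if xy: "x \<in> \<Union>C" "y \<in> \<Union>C" for x y
    proof -
      obtain U W where UW: "U \<in> C" "W \<in> C" "x \<in> U" "y \<in> W" using xy by blast
      then have "U \<subseteq> W \<or> W \<subseteq> U" using C(2) by (auto simp: subset_chain_def)
      then show ?thesis using UW by blast
    qed
    have "submonoid (\<Union>C) G"
    proof
      have sub: "submonoid P G" if "P \<in> C" for P using cone[OF that] by (simp add: positive_cone_def)
      then show "\<Union>C \<subseteq> carrier G" by (simp add: Sup_least submonoid.subset)
      obtain P where "P \<in> C" using C(1) by blast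
      then show "\<one> \<in> \<Union>C" using submonoid.one_closed[OF sub] by blast
      show "x \<otimes> y \<in> \<Union>C" if xy: "x \<in> \<Union>C" "y \<in> \<Union>C" for x y
      proof -
        obtain P where P: "P \<in> C" "x \<in> P" "y \<in> P" using two[OF xy] by blast
        then have "submonoid P G" using cone by (simp add: positive_cone_def)
        then show ?thesis using P submonoid.m_closed by fast
      qed
    qed
    moreover have "x = \<one>" if x: "x \<in> \<Union>C" "inv x \<in> \<Union>C" for x
    proof -
      obtain P where "P \<in> C" "x \<in> P" "inv x \<in> P" using two[OF x] by blast
      then show ?thesis using cone by (simp add: positive_cone_def)
    qed
    ultimately show "\<Union>C \<in> Collect (positive_cone G)" by (auto simp: positive_cone_def)
  qed
  then obtain P where P: "positive_cone G P"
    and max: "\<And>Q. positive_cone G Q \<Longrightarrow> P \<subseteq> Q \<Longrightarrow> Q = P" by auto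
  interpret P: submonoid P G using P by (simp add: positive_cone_def)
  have dich: "x \<in> P \<or> (\<exists>n::nat. n > 0 \<and> inv (x [^] n) \<in> P)" if x: "x \<in> carrier G" for x
  proof (rule disjCI)
    assume no: "\<not> (\<exists>n::nat. n > 0 \<and> inv (x [^] n) \<in> P)"
    let ?Q = "{p \<otimes> x [^] n |p n. p \<in> P \<and> n \<in> (UNIV :: nat set)}"
    have Q: "positive_cone G ?Q" by (rule positive_cone_adjoin[OF P x]) (use no in blast)
    have QI: "p \<otimes> x [^] n \<in> ?Q" if "p \<in> P" for p and n :: nat using that by blast
    have "P \<subseteq> ?Q"
    proof
      fix p assume p: "p \<in> P"
      then have "p \<otimes> x [^] (0::nat) = p" using P.subset by auto
      then show "p \<in> ?Q" using QI[OF p, of 0] by (simp only:)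
    qed
    then have QP: "?Q = P" by (rule max[OF Q])
    have "\<one> \<otimes> x [^] (1::nat) \<in> P" using QI[OF P.one_closed, of 1] by (simp only: QP)
    then show "x \<in> P" using x by simp
  qed
  have pow: "y [^] n \<in> P" if "y \<in> P" for y and n :: nat
    using that by (induction n) auto
  have "x \<in> P \<or> inv x \<in> P" if x: "x \<in> carrier G" for x
  proof (rule ccontr)
    assume not: "\<not> (x \<in> P \<or> inv x \<in> P)"
    obtain n :: nat where n: "n > 0" "inv (x [^] n) \<in> P" using dich[OF x] not by blast
    obtain m :: nat where m: "m > 0" "inv (inv x [^] m) \<in> P"
      using dich[OF inv_closed[OF x]] not by blast
    have "x [^] m \<in> P" using m x by (simp add: nat_pow_inv)
    then have "(x [^] m) [^] n \<in> P" by (rule pow)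
    moreover have "inv ((x [^] m) [^] n) = inv (x [^] n) [^] m"
      using x by (simp add: nat_pow_inv nat_pow_pow mult.commute)
    then have "inv ((x [^] m) [^] n) \<in> P" using pow[OF n(2)] by simp
    ultimately have "(x [^] m) [^] n = \<one>" using P by (auto simp: positive_cone_def)
    then have "x [^] (m * n) = \<one>" using x by (simp add: nat_pow_pow)
    then have "x = \<one>"
      using tf[unfolded torsion_free_def, rule_format, OF x, of "m * n"] n(1) m(1) by simp
    then show False using not P.one_closed by simp
  qed
  then show ?thesis using P by blast
qed

lemma (in group) positive_cone_finite_max:
  assumes P: "positive_cone G P" and total: "\<forall>x\<in>carrier G. x \<in> P \<or> inv x \<in> P"
    and "finite A" and "A \<noteq> {}" and "A \<subseteq> carrier G"
  shows "\<exists>a\<in>A. \<forall>c\<in>A. a \<otimes> inv c \<in> P"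
  using assms(3-)
proof (induction A rule: finite_ne_induct)
  interpret P: submonoid P G using P by (simp add: positive_cone_def)
  {
    case (singleton x)
    then show ?case using P.one_closed by simp
  next
    case (insert x F)
    then obtain a where a: "a \<in> F" "\<forall>c\<in>F. a \<otimes> inv c \<in> P" by auto
    have cl: "x \<in> carrier G" "a \<in> carrier G" using insert.prems a(1) by auto
    show ?case
    proof (cases "a \<otimes> inv x \<in> P")
      case True
      then show ?thesis using a by blast
    next
      case False
      then have "x \<otimes> inv a \<in> P" using total cl by (force simp: inv_mult_group)
      then have "x \<otimes> inv c \<in> P" if c: "c \<in> F" for c
      proof -
        have "(x \<otimes> inv a) \<otimes> (a \<otimes> inv c) \<in> P" 
          using \<open>x \<otimes> inv a \<in> P\<close> bspec[OF a(2) c] by (rule P.m_closed)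
        moreover have "c \<in> carrier G" using c insert.prems by auto
        ultimately show ?thesis using cl by (simp add: m_assoc inv_cancel_left)
      qed
      moreover have "x \<otimes> inv x \<in> P" using cl P.one_closed by simp
      ultimately show ?thesis by blast
    qed
  }
qed

text \<open>
  From \<open>c \<le> a\<close>, \<open>d \<le> b\<close> and \<open>c d = a b\<close> it follows that \<open>a / c = d / b\<close> is both \<open>\<ge> \<one>\<close> and \<open>\<le> \<one>\<close>.
\<close>

lemma (in comm_group) positive_cone_unique_product:
  assumes P: "positive_cone G P"
    and cl: "a \<in> carrier G" "b \<in> carrier G" "c \<in> carrier G" "d \<in> carrier G"
    and ca: "a \<otimes> inv c \<in> P" and db: "b \<otimes> inv d \<in> P" and eq: "c \<otimes> d = a \<otimes> b"
  shows "c = a \<and> d = b"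
proof -
  have "inv (a \<otimes> inv c) = inv a \<otimes> (c \<otimes> d) \<otimes> inv d"
    using cl by (simp add: inv_mult m_assoc)
  also have "\<dots> = b \<otimes> inv d" unfolding eq using cl by (simp add: m_assoc inv_cancel_left)
  finally have inv: "inv (a \<otimes> inv c) = b \<otimes> inv d" .
  then have one: "a \<otimes> inv c = \<one>" using P ca db by (auto simp: positive_cone_def)
  have "a = (a \<otimes> inv c) \<otimes> c" using cl by (simp add: m_assoc)
  then have "a = c" using one cl by simp
  then show ?thesis using eq cl by simp
qed

text \<open>
  The pairs are the two maxima and the two minima of \<open>A\<close> and \<open>B\<close>. If the maximum and the minimum of \<open>A\<close>
  coincide, then \<open>A\<close> is a singleton.
\<close>

lemma (in comm_group) torsion_free_two_unique_products:
  assumes tf: "torsion_free G"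
    and A: "finite A" "A \<noteq> {}" "A \<subseteq> carrier G"
    and B: "finite B" "B \<noteq> {}" "B \<subseteq> carrier G"
  shows "\<exists>a\<in>A. \<exists>b\<in>B. \<exists>a'\<in>A. \<exists>b'\<in>B.
    (\<forall>c\<in>A. \<forall>d\<in>B. c \<otimes> d = a \<otimes> b \<longrightarrow> c = a \<and> d = b) \<and>
    (\<forall>c\<in>A. \<forall>d\<in>B. c \<otimes> d = a' \<otimes> b' \<longrightarrow> c = a' \<and> d = b') \<and>
    (a = a' \<longrightarrow> A = {a})"
proof -
  obtain P where P: "positive_cone G P" and total: "\<forall>x\<in>carrier G. x \<in> P \<or> inv x \<in> P"
    using torsion_free_total_positive_cone[OF tf] by blast
  interpret P: submonoid P G using P by (simp add: positive_cone_def)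
  \<comment> \<open>The reversed order, whose maxima are the minima of the original one.\<close>
  define Q where "Q = {x \<in> carrier G. inv x \<in> P}"
  have "submonoid Q G" by standard (auto simp: Q_def inv_mult)
  moreover have "x = \<one>" if "x \<in> Q" "inv x \<in> Q" for x
  proof -
    have x: "x \<in> carrier G" "inv x \<in> P" "inv (inv x) \<in> P" using that by (auto simp: Q_def)
    then have "inv x = \<one>" using P unfolding positive_cone_def by blast
    then show ?thesis using x(1) by simp
  qed
  ultimately have Q: "positive_cone G Q" unfolding positive_cone_def by blast
  have Qtotal: "\<forall>x\<in>carrier G. x \<in> Q \<or> inv x \<in> Q"
    using total by (auto simp: Q_def)
  obtain a b where ab: "a \<in> A" "\<forall>c\<in>A. a \<otimes> inv c \<in> P" "b \<in> B" "\<forall>d\<in>B. b \<otimes> inv d \<in> P"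
    using positive_cone_finite_max[OF P total A] positive_cone_finite_max[OF P total B] by auto
  obtain a' b' where a'b': "a' \<in> A" "\<forall>c\<in>A. a' \<otimes> inv c \<in> Q" "b' \<in> B" "\<forall>d\<in>B. b' \<otimes> inv d \<in> Q"
    using positive_cone_finite_max[OF Q Qtotal A] positive_cone_finite_max[OF Q Qtotal B] by auto
  have "A = {a}" if aa': "a = a'"
  proof -
    have "c = a" if c: "c \<in> A" for c
    proof -
      have cl: "a \<in> carrier G" "c \<in> carrier G" using A c ab(1) by auto
      have "a \<otimes> inv c \<in> P" "inv (a \<otimes> inv c) \<in> P"
        using ab(2) a'b'(2) c aa' by (auto simp: Q_def)
      then have "a \<otimes> inv c = \<one>" using P by (auto simp: positive_cone_def)
      moreover have "a = (a \<otimes> inv c) \<otimes> c" using cl by (simp add: m_assoc)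
      ultimately show ?thesis using cl by simp
    qed
    then show ?thesis using ab(1) by blast
  qed
  moreover have "\<forall>c\<in>A. \<forall>d\<in>B. c \<otimes> d = a \<otimes> b \<longrightarrow> c = a \<and> d = b"
    by (intro ballI impI, rule positive_cone_unique_product[OF P]) (use ab A B in auto)
  moreover have "\<forall>c\<in>A. \<forall>d\<in>B. c \<otimes> d = a' \<otimes> b' \<longrightarrow> c = a' \<and> d = b'"
    by (intro ballI impI, rule positive_cone_unique_product[OF Q]) (use a'b' A B in auto)
  ultimately show ?thesis
    by (intro bexI[OF _ ab(1)] bexI[OF _ ab(3)] bexI[OF _ a'b'(1)] bexI[OF _ a'b'(3)] conjI impI)
qed

section \<open>Homogeneous components\<close>

context graded_ring
begin

definition hcomp :: "'r \<Rightarrow> 'g \<Rightarrow> 'r" where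
  "hcomp x = (THE f. f \<in> (\<Pi>\<^sub>E g\<in>carrier G. S g) \<and> finite {g \<in> carrier G. f g \<noteq> \<zero>\<^bsub>R\<^esub>} \<and>
     x = finsum R f {g \<in> carrier G. f g \<noteq> \<zero>\<^bsub>R\<^esub>})"

definition supp :: "'r \<Rightarrow> 'g set" where
  "supp x = {g \<in> carrier G. hcomp x g \<noteq> \<zero>\<^bsub>R\<^esub>}"

lemma hcomp_decomposition:
  assumes "x \<in> carrier R"
  shows "hcomp x \<in> (\<Pi>\<^sub>E g\<in>carrier G. S g)" and "finite (supp x)"
    and "x = finsum R (hcomp x) (supp x)"
  using theI'[OF direct_sum[OF assms]] unfolding hcomp_def[symmetric] supp_def by blast+

lemma hcomp_mem: "x \<in> carrier R \<Longrightarrow> g \<in> carrier G \<Longrightarrow> hcomp x g \<in> S g"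
  using hcomp_decomposition(1)[of x] by (auto simp: PiE_iff)

lemma hcomp_closed: "x \<in> carrier R \<Longrightarrow> g \<in> carrier G \<Longrightarrow> hcomp x g \<in> carrier R"
  using hcomp_mem component_carrier by blast

lemma supp_subset: "supp x \<subseteq> carrier G"
  by (auto simp: supp_def)

lemma hcomp_eq_zero: "g \<in> carrier G - supp x \<Longrightarrow> hcomp x g = \<zero>\<^bsub>R\<^esub>"
  by (auto simp: supp_def)

lemma hcomp_eqI:
  assumes f: "\<And>g. g \<in> carrier G \<Longrightarrow> f g \<in> S g" and A: "finite A" "A \<subseteq> carrier G"
    and f0: "\<And>g. g \<in> carrier G - A \<Longrightarrow> f g = \<zero>\<^bsub>R\<^esub>"
    and x: "x = finsum R f A" and h: "h \<in> carrier G"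
  shows "hcomp x h = f h"
proof -
  have "x \<in> carrier R"
    unfolding x by (rule R.finsum_closed) (use f A component_carrier in blast)
  note x' = hcomp_decomposition[OF this]
  show ?thesis
  proof (rule decomposition_unique[OF _ x'(2) supp_subset hcomp_eq_zero _ A f0 _ h])
    show "finsum R (hcomp x) (supp x) = finsum R f A" using x x'(3) by simp
  qed (use x'(1) f in auto)
qed

lemma supp_eq_empty_iff:
  assumes "x \<in> carrier R"
  shows "supp x = {} \<longleftrightarrow> x = \<zero>\<^bsub>R\<^esub>"
proof
  assume "supp x = {}"
  then show "x = \<zero>\<^bsub>R\<^esub>" using hcomp_decomposition(3)[OF assms] by simp
next
  assume x: "x = \<zero>\<^bsub>R\<^esub>"
  have "hcomp x g = \<zero>\<^bsub>R\<^esub>" if "g \<in> carrier G" for g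
    by (rule hcomp_eqI[of "\<lambda>_. \<zero>\<^bsub>R\<^esub>" "{}"]) (use that x component_zero in auto)
  then show "supp x = {}" by (auto simp: supp_def)
qed

lemma hcomp_homogeneous:
  assumes "g \<in> carrier G" and "x \<in> S g" and "h \<in> carrier G"
  shows "hcomp x h = (if h = g then x else \<zero>\<^bsub>R\<^esub>)"
proof (rule hcomp_eqI[of _ "{g}"])
  show "x = (\<Oplus>\<^bsub>R\<^esub>h\<in>{g}. if h = g then x else \<zero>\<^bsub>R\<^esub>)"
    using component_carrier[OF assms(1,2)] by simp
qed (use assms component_zero in auto)

lemma supp_singleton_mem:
  assumes x: "x \<in> carrier R" and "supp x = {g}"
  shows "x \<in> S g"
proof -
  have g: "g \<in> carrier G" using assms(2) supp_subset by blast
  have "x = hcomp x g"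
    using hcomp_decomposition(3)[OF x] hcomp_closed[OF x g] unfolding assms(2) by simp
  then show ?thesis using hcomp_mem[OF x g] by simp
qed

lemma hcomp_add:
  assumes x: "x \<in> carrier R" and y: "y \<in> carrier R" and k: "k \<in> carrier G"
  shows "hcomp (x \<oplus>\<^bsub>R\<^esub> y) k = hcomp x k \<oplus>\<^bsub>R\<^esub> hcomp y k"
proof (rule hcomp_eqI[OF _ _ _ _ _ k])
  let ?A = "supp x \<union> supp y"
  have extend: "z = finsum R (hcomp z) ?A" if z: "z \<in> carrier R" "supp z \<subseteq> ?A" for z
  proof -
    have "finsum R (hcomp z) (supp z) = finsum R (hcomp z) ?A"
      by (rule R.add.finprod_mono_neutral_cong_left)
        (use z x y hcomp_decomposition(2) hcomp_eq_zero supp_subset hcomp_closed in blast)+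
    then show ?thesis using hcomp_decomposition(3)[OF z(1)] by simp
  qed
  show "x \<oplus>\<^bsub>R\<^esub> y = (\<Oplus>\<^bsub>R\<^esub>g\<in>?A. hcomp x g \<oplus>\<^bsub>R\<^esub> hcomp y g)"
  proof -
    have "(\<Oplus>\<^bsub>R\<^esub>g\<in>?A. hcomp x g \<oplus>\<^bsub>R\<^esub> hcomp y g) = finsum R (hcomp x) ?A \<oplus>\<^bsub>R\<^esub> finsum R (hcomp y) ?A"
      by (rule R.finsum_addf) (use x y supp_subset hcomp_closed in blast)+
    then show ?thesis using extend[OF x] extend[OF y] by simp
  qed
  show "hcomp x g \<oplus>\<^bsub>R\<^esub> hcomp y g \<in> S g" if g: "g \<in> carrier G" for g
    using additive_subgroup.a_closed[OF component_subgroup[OF g]] hcomp_mem x y g by blast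
  show "finite ?A" using hcomp_decomposition(2) x y by blast
  show "?A \<subseteq> carrier G" using supp_subset by blast
  show "hcomp x g \<oplus>\<^bsub>R\<^esub> hcomp y g = \<zero>\<^bsub>R\<^esub>" if "g \<in> carrier G - ?A" for g
    using that hcomp_eq_zero by simp
qed

lemma hcomp_finsum:
  assumes "finite A" and "F \<in> A \<rightarrow> carrier R" and k: "k \<in> carrier G"
  shows "hcomp (finsum R F A) k = (\<Oplus>\<^bsub>R\<^esub>a\<in>A. hcomp (F a) k)"
  using assms(1,2)
proof (induction A rule: finite_induct)
  case empty
  have "hcomp \<zero>\<^bsub>R\<^esub> k = \<zero>\<^bsub>R\<^esub>" using supp_eq_empty_iff[of "\<zero>\<^bsub>R\<^esub>"] k by (auto simp: supp_def)
  then show ?case by simp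
next
  case (insert a A)
  then have F: "F a \<in> carrier R" "F \<in> A \<rightarrow> carrier R" by auto
  have "(\<lambda>b. hcomp (F b) k) \<in> A \<rightarrow> carrier R" using F(2) hcomp_closed[OF _ k] by auto
  then show ?case
    using insert.hyps insert.IH[OF F(2)] F k
    by (simp add: hcomp_add hcomp_closed R.finsum_closed)
qed

lemma hcomp_homogeneous_mult:
  assumes h: "h \<in> carrier G" and r: "r \<in> S h" and x: "x \<in> carrier R" and k: "k \<in> carrier G"
  shows "hcomp (r \<otimes>\<^bsub>R\<^esub> x) k = r \<otimes>\<^bsub>R\<^esub> hcomp x (inv\<^bsub>G\<^esub> h \<otimes>\<^bsub>G\<^esub> k)"
proof (rule hcomp_eqI[OF _ _ _ _ _ k])
  let ?m = "\<lambda>g. h \<otimes>\<^bsub>G\<^esub> g"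
  have rR: "r \<in> carrier R" using component_carrier[OF h r] .
  have canc: "inv\<^bsub>G\<^esub> h \<otimes>\<^bsub>G\<^esub> (h \<otimes>\<^bsub>G\<^esub> g) = g" "h \<otimes>\<^bsub>G\<^esub> (inv\<^bsub>G\<^esub> h \<otimes>\<^bsub>G\<^esub> g) = g"
    if "g \<in> carrier G" for g using that h by (simp_all add: G.m_assoc[symmetric])
  show mem: "r \<otimes>\<^bsub>R\<^esub> hcomp x (inv\<^bsub>G\<^esub> h \<otimes>\<^bsub>G\<^esub> g) \<in> S g" if g: "g \<in> carrier G" for g
    using component_mult_mem[OF h _ r hcomp_mem[OF x], of "inv\<^bsub>G\<^esub> h \<otimes>\<^bsub>G\<^esub> g"] h g canc(2)[OF g]
    by simp
  show "finite (?m ` supp x)" using hcomp_decomposition(2)[OF x] by simp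
  show sub: "?m ` supp x \<subseteq> carrier G" using h supp_subset by auto
  show "r \<otimes>\<^bsub>R\<^esub> hcomp x (inv\<^bsub>G\<^esub> h \<otimes>\<^bsub>G\<^esub> g) = \<zero>\<^bsub>R\<^esub>" if g: "g \<in> carrier G - ?m ` supp x" for g
  proof -
    have "inv\<^bsub>G\<^esub> h \<otimes>\<^bsub>G\<^esub> g \<in> carrier G - supp x" using g h canc(2)[of g] by force
    then show ?thesis using hcomp_eq_zero rR by simp
  qed
  have inj: "inj_on ?m (supp x)"
    by (rule inj_onI) (use h supp_subset G.l_cancel in blast)
  have "finsum R (\<lambda>g. r \<otimes>\<^bsub>R\<^esub> hcomp x (inv\<^bsub>G\<^esub> h \<otimes>\<^bsub>G\<^esub> g)) (?m ` supp x) =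
      (\<Oplus>\<^bsub>R\<^esub>g\<in>supp x. r \<otimes>\<^bsub>R\<^esub> hcomp x (inv\<^bsub>G\<^esub> h \<otimes>\<^bsub>G\<^esub> (h \<otimes>\<^bsub>G\<^esub> g)))"
    by (rule R.finsum_reindex[OF _ inj]) (use mem sub component_carrier in blast)
  also have "\<dots> = (\<Oplus>\<^bsub>R\<^esub>g\<in>supp x. r \<otimes>\<^bsub>R\<^esub> hcomp x g)"
    by (rule R.finsum_cong'[OF refl])
      (use canc(1) supp_subset hcomp_closed[OF x] rR in \<open>auto simp: subset_iff\<close>)
  also have "\<dots> = r \<otimes>\<^bsub>R\<^esub> finsum R (hcomp x) (supp x)"
    by (rule R.finsum_rdistr[symmetric])
      (use hcomp_decomposition(2)[OF x] rR supp_subset hcomp_closed[OF x] in blast)+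
  finally show "r \<otimes>\<^bsub>R\<^esub> x = finsum R (\<lambda>g. r \<otimes>\<^bsub>R\<^esub> hcomp x (inv\<^bsub>G\<^esub> h \<otimes>\<^bsub>G\<^esub> g)) (?m ` supp x)"
    using hcomp_decomposition(3)[OF x] by simp
qed

lemma hcomp_mult:
  assumes x: "x \<in> carrier R" and y: "y \<in> carrier R" and k: "k \<in> carrier G"
  shows "hcomp (x \<otimes>\<^bsub>R\<^esub> y) k =
    (\<Oplus>\<^bsub>R\<^esub>g\<in>supp x. hcomp x g \<otimes>\<^bsub>R\<^esub> hcomp y (inv\<^bsub>G\<^esub> g \<otimes>\<^bsub>G\<^esub> k))"
proof -
  have fin: "finite (supp x)" using hcomp_decomposition(2)[OF x] .
  have xg: "hcomp x g \<in> carrier R" if "g \<in> supp x" for g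
    using hcomp_closed[OF x] supp_subset that by blast
  have "x \<otimes>\<^bsub>R\<^esub> y = finsum R (hcomp x) (supp x) \<otimes>\<^bsub>R\<^esub> y"
    using hcomp_decomposition(3)[OF x] by simp
  also have "\<dots> = (\<Oplus>\<^bsub>R\<^esub>g\<in>supp x. hcomp x g \<otimes>\<^bsub>R\<^esub> y)"
    by (rule R.finsum_ldistr) (use fin y xg in auto)
  finally have "hcomp (x \<otimes>\<^bsub>R\<^esub> y) k = (\<Oplus>\<^bsub>R\<^esub>g\<in>supp x. hcomp (hcomp x g \<otimes>\<^bsub>R\<^esub> y) k)"
    using hcomp_finsum[OF fin _ k, of "\<lambda>g. hcomp x g \<otimes>\<^bsub>R\<^esub> y"] y xg by simp
  also have "\<dots> = (\<Oplus>\<^bsub>R\<^esub>g\<in>supp x. hcomp x g \<otimes>\<^bsub>R\<^esub> hcomp y (inv\<^bsub>G\<^esub> g \<otimes>\<^bsub>G\<^esub> k))"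
  proof (rule R.finsum_cong'[OF refl])
    show "(\<lambda>g. hcomp x g \<otimes>\<^bsub>R\<^esub> hcomp y (inv\<^bsub>G\<^esub> g \<otimes>\<^bsub>G\<^esub> k)) \<in> supp x \<rightarrow> carrier R"
      using xg supp_subset k hcomp_closed[OF y] by (auto simp: subset_iff)
    show "hcomp (hcomp x g \<otimes>\<^bsub>R\<^esub> y) k = hcomp x g \<otimes>\<^bsub>R\<^esub> hcomp y (inv\<^bsub>G\<^esub> g \<otimes>\<^bsub>G\<^esub> k)"
      if "g \<in> supp x" for g
      using that supp_subset by (intro hcomp_homogeneous_mult hcomp_mem x y k) auto
  qed
  finally show ?thesis .
qed

text \<open>
  If \<open>a b\<close> arises from no other pair of a degree of \<open>x\<close> and a degree of \<open>y\<close>, then every other term of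
  the convolution formula vanishes in this degree, and nothing can cancel the term of \<open>(a, b)\<close>.
\<close>

lemma hcomp_mult_unique_product:
  assumes x: "x \<in> carrier R" and y: "y \<in> carrier R" and a: "a \<in> supp x" and b: "b \<in> carrier G"
    and unique: "\<And>g h. g \<in> supp x \<Longrightarrow> h \<in> supp y \<Longrightarrow> g \<otimes>\<^bsub>G\<^esub> h = a \<otimes>\<^bsub>G\<^esub> b \<Longrightarrow> g = a"
  shows "hcomp (x \<otimes>\<^bsub>R\<^esub> y) (a \<otimes>\<^bsub>G\<^esub> b) = hcomp x a \<otimes>\<^bsub>R\<^esub> hcomp y b"
proof -
  have aG: "a \<in> carrier G" using a supp_subset by blast
  let ?t = "hcomp x a \<otimes>\<^bsub>R\<^esub> hcomp y b"
  have t: "?t \<in> carrier R" using x y aG b by (intro R.m_closed hcomp_closed)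
  have "hcomp (x \<otimes>\<^bsub>R\<^esub> y) (a \<otimes>\<^bsub>G\<^esub> b) =
      (\<Oplus>\<^bsub>R\<^esub>g\<in>supp x. hcomp x g \<otimes>\<^bsub>R\<^esub> hcomp y (inv\<^bsub>G\<^esub> g \<otimes>\<^bsub>G\<^esub> (a \<otimes>\<^bsub>G\<^esub> b)))"
    using hcomp_mult[OF x y] aG b by simp
  also have "\<dots> = (\<Oplus>\<^bsub>R\<^esub>g\<in>supp x. if a = g then ?t else \<zero>\<^bsub>R\<^esub>)"
  proof (rule R.finsum_cong'[OF refl])
    fix g assume g: "g \<in> supp x"
    have gG: "g \<in> carrier G" using g supp_subset by blast
    let ?h = "inv\<^bsub>G\<^esub> g \<otimes>\<^bsub>G\<^esub> (a \<otimes>\<^bsub>G\<^esub> b)"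
    have h: "?h \<in> carrier G" "g \<otimes>\<^bsub>G\<^esub> ?h = a \<otimes>\<^bsub>G\<^esub> b"
      using gG aG b by (simp_all add: G.m_assoc[symmetric])
    show "hcomp x g \<otimes>\<^bsub>R\<^esub> hcomp y ?h = (if a = g then ?t else \<zero>\<^bsub>R\<^esub>)"
    proof (cases "a = g")
      case True
      have "inv\<^bsub>G\<^esub> a \<otimes>\<^bsub>G\<^esub> (a \<otimes>\<^bsub>G\<^esub> b) = b" using aG b by (simp add: G.m_assoc[symmetric])
      then show ?thesis using True by simp
    next
      case False
      then have "?h \<notin> supp y" using unique[OF g _ h(2)] by blast
      then have "hcomp y ?h = \<zero>\<^bsub>R\<^esub>" using hcomp_eq_zero h(1) by blast
      then show ?thesis using False hcomp_closed[OF x gG] by simp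
    qed
  qed (use t in auto)
  also have "\<dots> = ?t"
    by (rule R.add.finprod_singleton[OF a hcomp_decomposition(2)[OF x]]) (use t in auto)
  finally show ?thesis .
qed

end

section \<open>Non-degenerate gradings over a domain\<close>

locale nondegenerate_domain_graded_ring = graded_ring G R S
  for G :: "('g, 'm) monoid_scheme" and R :: "('r, 'n) ring_scheme" and S :: "'g \<Rightarrow> 'r set" +
  assumes nondegenerate: "nondegenerate_grading G R S"
    and domain_component_one: "noncomm_domain (R\<lparr>carrier := S \<one>\<^bsub>G\<^esub>\<rparr>)"
begin

text \<open>
  As \<open>S (inv g)\<close> contains \<open>\<zero>\<close>, the sets \<open>S (inv g) a\<close> and \<open>a S (inv g)\<close> cannot be empty; being different from
  \<open>{\<zero>}\<close>, they have a non-zero member.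
\<close>

lemma inverse_degree_multipliers:
  assumes g: "g \<in> carrier G" and a: "a \<in> S g" "a \<noteq> \<zero>\<^bsub>R\<^esub>"
  shows "\<exists>c\<in>S (inv\<^bsub>G\<^esub> g). c \<otimes>\<^bsub>R\<^esub> a \<noteq> \<zero>\<^bsub>R\<^esub>" and "\<exists>c\<in>S (inv\<^bsub>G\<^esub> g). a \<otimes>\<^bsub>R\<^esub> c \<noteq> \<zero>\<^bsub>R\<^esub>"
proof -
  have nonempty: "\<zero>\<^bsub>R\<^esub> \<in> S (inv\<^bsub>G\<^esub> g)" using component_zero g by simp
  have "S (inv\<^bsub>G\<^esub> g) #>\<^bsub>R\<^esub> a \<noteq> {\<zero>\<^bsub>R\<^esub>}" "a <#\<^bsub>R\<^esub> S (inv\<^bsub>G\<^esub> g) \<noteq> {\<zero>\<^bsub>R\<^esub>}"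
    using nondegenerate g a unfolding nondegenerate_grading_def by blast+
  moreover have "S (inv\<^bsub>G\<^esub> g) #>\<^bsub>R\<^esub> a = {\<zero>\<^bsub>R\<^esub>}" if "\<forall>c\<in>S (inv\<^bsub>G\<^esub> g). c \<otimes>\<^bsub>R\<^esub> a = \<zero>\<^bsub>R\<^esub>"
    using that nonempty unfolding r_coset_def by auto
  moreover have "a <#\<^bsub>R\<^esub> S (inv\<^bsub>G\<^esub> g) = {\<zero>\<^bsub>R\<^esub>}" if "\<forall>c\<in>S (inv\<^bsub>G\<^esub> g). a \<otimes>\<^bsub>R\<^esub> c = \<zero>\<^bsub>R\<^esub>"
    using that nonempty unfolding l_coset_def by auto
  ultimately show "\<exists>c\<in>S (inv\<^bsub>G\<^esub> g). c \<otimes>\<^bsub>R\<^esub> a \<noteq> \<zero>\<^bsub>R\<^esub>" "\<exists>c\<in>S (inv\<^bsub>G\<^esub> g). a \<otimes>\<^bsub>R\<^esub> c \<noteq> \<zero>\<^bsub>R\<^esub>"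
    by blast+
qed

text \<open>
  Multiply \<open>a\<close> on the left and \<open>b\<close> on the right so that both move, without vanishing, into the component
  of degree \<open>\<one>\<close>, which is a domain.
\<close>

lemma homogeneous_mult_nonzero:
  assumes g: "g \<in> carrier G" and h: "h \<in> carrier G" and a: "a \<in> S g" and b: "b \<in> S h"
    and nz: "a \<noteq> \<zero>\<^bsub>R\<^esub>" "b \<noteq> \<zero>\<^bsub>R\<^esub>"
  shows "a \<otimes>\<^bsub>R\<^esub> b \<noteq> \<zero>\<^bsub>R\<^esub>"
proof
  assume ab: "a \<otimes>\<^bsub>R\<^esub> b = \<zero>\<^bsub>R\<^esub>"
  have aR: "a \<in> carrier R" and bR: "b \<in> carrier R" using component_carrier g h a b by auto
  obtain c where c: "c \<in> S (inv\<^bsub>G\<^esub> g)" "c \<otimes>\<^bsub>R\<^esub> a \<noteq> \<zero>\<^bsub>R\<^esub>"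
    using inverse_degree_multipliers(1)[OF g a nz(1)] by blast
  obtain d where d: "d \<in> S (inv\<^bsub>G\<^esub> h)" "b \<otimes>\<^bsub>R\<^esub> d \<noteq> \<zero>\<^bsub>R\<^esub>"
    using inverse_degree_multipliers(2)[OF h b nz(2)] by blast
  have cR: "c \<in> carrier R" and dR: "d \<in> carrier R"
    using component_carrier[OF _ c(1)] component_carrier[OF _ d(1)] g h by auto
  have "c \<otimes>\<^bsub>R\<^esub> a \<in> S \<one>\<^bsub>G\<^esub>" "b \<otimes>\<^bsub>R\<^esub> d \<in> S \<one>\<^bsub>G\<^esub>"
    using component_mult_mem[OF _ g c(1) a] component_mult_mem[OF h _ b d(1)] g h by auto
  then have "(c \<otimes>\<^bsub>R\<^esub> a) \<otimes>\<^bsub>R\<^esub> (b \<otimes>\<^bsub>R\<^esub> d) \<noteq> \<zero>\<^bsub>R\<^esub>"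
    using domain_component_one c(2) d(2) unfolding noncomm_domain_def by simp
  moreover have "(c \<otimes>\<^bsub>R\<^esub> a) \<otimes>\<^bsub>R\<^esub> (b \<otimes>\<^bsub>R\<^esub> d) = c \<otimes>\<^bsub>R\<^esub> (a \<otimes>\<^bsub>R\<^esub> b) \<otimes>\<^bsub>R\<^esub> d"
    using aR bR cR dR by (simp add: R.m_assoc)
  ultimately show False using ab cR dR by simp
qed

lemma one_nonzero: "\<one>\<^bsub>R\<^esub> \<noteq> \<zero>\<^bsub>R\<^esub>"
proof
  assume one: "\<one>\<^bsub>R\<^esub> = \<zero>\<^bsub>R\<^esub>"
  have "a = \<zero>\<^bsub>R\<^esub>" if a: "a \<in> S \<one>\<^bsub>G\<^esub>" for a
    using R.l_one[OF component_carrier[OF G.one_closed a]] R.l_null[OF component_carrier[OF G.one_closed a]]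
    unfolding one by simp
  then have "S \<one>\<^bsub>G\<^esub> = {\<zero>\<^bsub>R\<^esub>}" using component_zero[OF G.one_closed] by blast
  then show False using domain_component_one by (simp add: noncomm_domain_def)
qed

definition degrees :: "'g set" where
  "degrees = {g \<in> carrier G. S g \<noteq> {\<zero>\<^bsub>R\<^esub>}}"

lemma degrees_nonzeroE:
  assumes "g \<in> degrees"
  obtains r where "r \<in> S g" and "r \<noteq> \<zero>\<^bsub>R\<^esub>"
  using assms component_zero unfolding degrees_def by blast

lemma degreesI: "g \<in> carrier G \<Longrightarrow> r \<in> S g \<Longrightarrow> r \<noteq> \<zero>\<^bsub>R\<^esub> \<Longrightarrow> g \<in> degrees"
  by (auto simp: degrees_def)

lemma subgroup_degrees: "subgroup degrees G"
proof (rule G.subgroupI)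
  show "degrees \<subseteq> carrier G" by (auto simp: degrees_def)
  show "degrees \<noteq> {}" using degreesI[OF G.one_closed one_in_component_one one_nonzero] by blast
next
  fix g assume g: "g \<in> degrees"
  then have gG: "g \<in> carrier G" by (simp add: degrees_def)
  obtain r where r: "r \<in> S g" "r \<noteq> \<zero>\<^bsub>R\<^esub>" by (rule degrees_nonzeroE[OF g])
  obtain c where c: "c \<in> S (inv\<^bsub>G\<^esub> g)" "c \<otimes>\<^bsub>R\<^esub> r \<noteq> \<zero>\<^bsub>R\<^esub>"
    using inverse_degree_multipliers(1)[OF gG r] by blast
  have "c \<noteq> \<zero>\<^bsub>R\<^esub>" using c(2) component_carrier[OF gG r(1)] by auto
  then show "inv\<^bsub>G\<^esub> g \<in> degrees" by (rule degreesI[OF G.inv_closed[OF gG] c(1)])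
next
  fix g h assume g: "g \<in> degrees" and h: "h \<in> degrees"
  have gG: "g \<in> carrier G" and hG: "h \<in> carrier G" using g h by (simp_all add: degrees_def)
  obtain r where r: "r \<in> S g" "r \<noteq> \<zero>\<^bsub>R\<^esub>" by (rule degrees_nonzeroE[OF g])
  obtain s where s: "s \<in> S h" "s \<noteq> \<zero>\<^bsub>R\<^esub>" by (rule degrees_nonzeroE[OF h])
  show "g \<otimes>\<^bsub>G\<^esub> h \<in> degrees"
    by (rule degreesI[OF G.m_closed[OF gG hG] component_mult_mem[OF gG hG r(1) s(1)]
        homogeneous_mult_nonzero[OF gG hG r(1) s(1) r(2) s(2)]])
qed

lemma supp_subset_degrees: "x \<in> carrier R \<Longrightarrow> supp x \<subseteq> degrees"
  using degreesI hcomp_mem by (auto simp: supp_def)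

text \<open>
  For \<open>r \<noteq> \<zero>\<close> of degree \<open>h\<close>, compare the components of \<open>x r = r x\<close> in degree \<open>g h\<close>: on the left it is
  \<open>x\<^sub>g r\<close>, which is not zero, and on the right it is \<open>r\<close> times the component of \<open>x\<close> in degree
  \<open>inv h \<otimes> g \<otimes> h\<close>.
\<close>

lemma supp_center_conjugation_closed:
  assumes x: "x \<in> ring_center R" and h: "h \<in> degrees" and g: "g \<in> supp x"
  shows "inv\<^bsub>G\<^esub> h \<otimes>\<^bsub>G\<^esub> g \<otimes>\<^bsub>G\<^esub> h \<in> supp x"
proof -
  have xR: "x \<in> carrier R" using x by (simp add: ring_center_def)
  have hG: "h \<in> carrier G" and gG: "g \<in> carrier G" and xg: "hcomp x g \<noteq> \<zero>\<^bsub>R\<^esub>"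
    using h g by (auto simp: degrees_def supp_def)
  obtain r where r: "r \<in> S h" "r \<noteq> \<zero>\<^bsub>R\<^esub>" by (rule degrees_nonzeroE[OF h])
  have rR: "r \<in> carrier R" by (rule component_carrier[OF hG r(1)])
  have "supp r = {h}" using hcomp_homogeneous[OF hG r(1)] hG r(2)
    by (auto simp: supp_def split: if_splits)
  then have "hcomp (x \<otimes>\<^bsub>R\<^esub> r) (g \<otimes>\<^bsub>G\<^esub> h) = hcomp x g \<otimes>\<^bsub>R\<^esub> hcomp r h"
    by (intro hcomp_mult_unique_product xR rR g hG)
      (use supp_subset gG hG in \<open>auto simp: subset_iff\<close>)
  also have "hcomp r h = r" using hcomp_homogeneous[OF hG r(1) hG] by simp
  also have "hcomp x g \<otimes>\<^bsub>R\<^esub> r \<noteq> \<zero>\<^bsub>R\<^esub>"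
    by (rule homogeneous_mult_nonzero[OF gG hG hcomp_mem[OF xR gG] r(1) xg r(2)])
  also have "x \<otimes>\<^bsub>R\<^esub> r = r \<otimes>\<^bsub>R\<^esub> x" using x rR by (simp add: ring_center_def)
  also have "hcomp (r \<otimes>\<^bsub>R\<^esub> x) (g \<otimes>\<^bsub>G\<^esub> h) = r \<otimes>\<^bsub>R\<^esub> hcomp x (inv\<^bsub>G\<^esub> h \<otimes>\<^bsub>G\<^esub> g \<otimes>\<^bsub>G\<^esub> h)"
    using hcomp_homogeneous_mult[OF hG r(1) xR] gG hG by (simp add: G.m_assoc)
  finally have "hcomp x (inv\<^bsub>G\<^esub> h \<otimes>\<^bsub>G\<^esub> g \<otimes>\<^bsub>G\<^esub> h) \<noteq> \<zero>\<^bsub>R\<^esub>" using rR by auto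
  then show ?thesis using gG hG by (simp add: supp_def)
qed

section \<open>Products with central elements\<close>

text \<open>
  All degrees of \<open>x\<close> lie in an abelian subgroup \<open>K\<close>, those of \<open>y\<close> may lie in several cosets of \<open>K\<close>. Left
  multiplication by elements of \<open>K\<close> preserves a right coset \<open>K t\<close>, so only the part of \<open>y\<close> in one such
  coset can meet the extreme terms, and dividing by \<open>t\<close> on the right moves this part into \<open>K\<close>.
\<close>

lemma center_mult_two_unique_degrees:
  assumes tf: "torsion_free G"
    and x: "x \<in> ring_center R" and x0: "x \<noteq> \<zero>\<^bsub>R\<^esub>"
    and y: "y \<in> carrier R" and y0: "y \<noteq> \<zero>\<^bsub>R\<^esub>"
  shows "\<exists>g\<in>supp (x \<otimes>\<^bsub>R\<^esub> y). \<exists>h\<in>supp (x \<otimes>\<^bsub>R\<^esub> y). g = h \<longrightarrow> (\<exists>a. supp x = {a})"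
proof -
  let ?A = "supp x" and ?H = "G\<lparr>carrier := degrees\<rparr>"
  have xR: "x \<in> carrier R" using x by (simp add: ring_center_def)
  have A: "finite ?A" "?A \<noteq> {}" "?A \<subseteq> degrees"
    using hcomp_decomposition(2)[OF xR] supp_eq_empty_iff[OF xR] x0 supp_subset_degrees[OF xR]
    by auto
  interpret H: group ?H by (rule subgroup.subgroup_is_group[OF subgroup_degrees G.is_group])
  define K where "K = generate G ?A"
  have K: "subgroup K G" unfolding K_def by (rule G.generate_is_subgroup[OF supp_subset])
  have KH: "K = generate ?H ?A"
    unfolding K_def by (rule G.generate_consistent[OF A(3) subgroup_degrees, symmetric])
  have commute: "a \<otimes>\<^bsub>G\<^esub> b = b \<otimes>\<^bsub>G\<^esub> a" if "a \<in> K" "b \<in> K" for a b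
  proof -
    have "a \<otimes>\<^bsub>?H\<^esub> b = b \<otimes>\<^bsub>?H\<^esub> a"
    proof (rule H.finite_conjugation_closed_commute[OF _ A(1)])
      show "torsion_free ?H" by (rule torsion_free_subgroup[OF G.is_group subgroup_degrees tf])
      show "inv\<^bsub>?H\<^esub> g \<otimes>\<^bsub>?H\<^esub> a \<otimes>\<^bsub>?H\<^esub> g \<in> ?A" if "g \<in> carrier ?H" "a \<in> ?A" for g a
        using supp_center_conjugation_closed[OF x _ that(2), of g] that(1)
          G.m_inv_consistent[OF subgroup_degrees] by simp
    qed (use A that KH in auto)
    then show ?thesis by simp
  qed
  interpret K: group "G\<lparr>carrier := K\<rparr>" by (rule subgroup.subgroup_is_group[OF K G.is_group])
  interpret K: comm_group "G\<lparr>carrier := K\<rparr>"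
    by (rule K.group_comm_groupI) (use commute in auto)
  have KG: "k \<in> carrier G" if "k \<in> K" for k using subgroup.mem_carrier[OF K that] .
  have AK: "?A \<subseteq> K" unfolding K_def by (auto intro: generate.incl)
  obtain t where t: "t \<in> supp y" using supp_eq_empty_iff[OF y] y0 by blast
  have tG: "t \<in> carrier G" using t supp_subset by blast
  define B where "B = {k \<in> K. k \<otimes>\<^bsub>G\<^esub> t \<in> supp y}"
  have B: "finite B" "B \<noteq> {}" "B \<subseteq> K"
  proof -
    have "inj_on (\<lambda>k. k \<otimes>\<^bsub>G\<^esub> t) B"
      by (rule inj_onI, erule G.r_cancel) (use KG tG in \<open>auto simp: B_def\<close>)
    moreover have "(\<lambda>k. k \<otimes>\<^bsub>G\<^esub> t) ` B \<subseteq> supp y" by (auto simp: B_def)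
    ultimately show "finite B" using hcomp_decomposition(2)[OF y] by (rule inj_on_finite)
    have "\<one>\<^bsub>G\<^esub> \<in> B" using t tG subgroup.one_closed[OF K] by (simp add: B_def)
    then show "B \<noteq> {}" by blast
  qed (auto simp: B_def)
  obtain a b a' b' where ab: "a \<in> ?A" "b \<in> B" "a' \<in> ?A" "b' \<in> B"
    and u: "\<forall>c\<in>?A. \<forall>d\<in>B. c \<otimes>\<^bsub>G\<^esub> d = a \<otimes>\<^bsub>G\<^esub> b \<longrightarrow> c = a \<and> d = b"
    and u': "\<forall>c\<in>?A. \<forall>d\<in>B. c \<otimes>\<^bsub>G\<^esub> d = a' \<otimes>\<^bsub>G\<^esub> b' \<longrightarrow> c = a' \<and> d = b'"
    and single: "a = a' \<longrightarrow> ?A = {a}"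
    using K.torsion_free_two_unique_products[OF torsion_free_subgroup[OF G.is_group K tf]
        A(1,2) _ B(1,2)] AK B(3) by auto
  have survive: "a \<otimes>\<^bsub>G\<^esub> (b \<otimes>\<^bsub>G\<^esub> t) \<in> supp (x \<otimes>\<^bsub>R\<^esub> y)"
    if a: "a \<in> ?A" and b: "b \<in> B"
      and u: "\<forall>c\<in>?A. \<forall>d\<in>B. c \<otimes>\<^bsub>G\<^esub> d = a \<otimes>\<^bsub>G\<^esub> b \<longrightarrow> c = a \<and> d = b" for a b
  proof -
    have aK: "a \<in> K" and bK: "b \<in> K" using a b AK B(3) by auto
    have aG: "a \<in> carrier G" and bG: "b \<in> carrier G" using KG[OF aK] KG[OF bK] by auto
    have bt: "b \<otimes>\<^bsub>G\<^esub> t \<in> supp y" "b \<otimes>\<^bsub>G\<^esub> t \<in> carrier G" using b bG tG by (auto simp: B_def)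
    have "g = a" if g: "g \<in> ?A" and h: "h \<in> supp y" and eq: "g \<otimes>\<^bsub>G\<^esub> h = a \<otimes>\<^bsub>G\<^esub> (b \<otimes>\<^bsub>G\<^esub> t)" for g h
    proof -
      have gK: "g \<in> K" using g AK by auto
      have gG: "g \<in> carrier G" and hG: "h \<in> carrier G" using KG[OF gK] h supp_subset by auto
      define d where "d = inv\<^bsub>G\<^esub> g \<otimes>\<^bsub>G\<^esub> (a \<otimes>\<^bsub>G\<^esub> b)"
      have dK: "d \<in> K"
        unfolding d_def using gK aK bK K
        by (simp add: subgroup.m_closed subgroup.m_inv_closed)
      have "h = inv\<^bsub>G\<^esub> g \<otimes>\<^bsub>G\<^esub> (g \<otimes>\<^bsub>G\<^esub> h)" using gG hG by (simp add: G.inv_cancel_left)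
      also have "\<dots> = d \<otimes>\<^bsub>G\<^esub> t" unfolding eq d_def using gG aG bG tG by (simp add: G.m_assoc)
      finally have "d \<in> B" using dK h by (simp add: B_def)
      moreover have "g \<otimes>\<^bsub>G\<^esub> d = a \<otimes>\<^bsub>G\<^esub> b"
        unfolding d_def using gG aG bG by (simp add: G.inv_cancel_left)
      ultimately show ?thesis using u g by blast
    qed
    then have "hcomp (x \<otimes>\<^bsub>R\<^esub> y) (a \<otimes>\<^bsub>G\<^esub> (b \<otimes>\<^bsub>G\<^esub> t)) = hcomp x a \<otimes>\<^bsub>R\<^esub> hcomp y (b \<otimes>\<^bsub>G\<^esub> t)"
      by (rule hcomp_mult_unique_product[OF xR y a bt(2)])
    also have "\<dots> \<noteq> \<zero>\<^bsub>R\<^esub>"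
      using a bt(1) by (intro homogeneous_mult_nonzero[OF aG bt(2)] hcomp_mem xR y aG bt(2))
        (auto simp: supp_def)
    finally show ?thesis using aG bt(2) by (simp add: supp_def)
  qed
  show ?thesis
  proof (rule bexI[OF _ survive[OF ab(1,2) u]], rule bexI[OF _ survive[OF ab(3,4) u']], rule impI)
    assume eq: "a \<otimes>\<^bsub>G\<^esub> (b \<otimes>\<^bsub>G\<^esub> t) = a' \<otimes>\<^bsub>G\<^esub> (b' \<otimes>\<^bsub>G\<^esub> t)"
    have cl: "a \<in> carrier G" "b \<in> carrier G" "a' \<in> carrier G" "b' \<in> carrier G"
      using ab AK B(3) KG by blast+
    have "(a \<otimes>\<^bsub>G\<^esub> b) \<otimes>\<^bsub>G\<^esub> t = (a' \<otimes>\<^bsub>G\<^esub> b') \<otimes>\<^bsub>G\<^esub> t"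
      using eq cl tG by (simp add: G.m_assoc)
    then have "a \<otimes>\<^bsub>G\<^esub> b = a' \<otimes>\<^bsub>G\<^esub> b'"
      using G.r_cancel[OF _ G.m_closed[OF cl(1,2)] G.m_closed[OF cl(3,4)] tG] by blast
    then have "a = a'" using bspec[OF bspec[OF u' ab(1)] ab(2)] by blast
    then show "\<exists>a. ?A = {a}" using single by blast
  qed
qed

lemma center_regular:
  assumes tf: "torsion_free G" and x: "x \<in> ring_center R" "x \<noteq> \<zero>\<^bsub>R\<^esub>"
    and y: "y \<in> carrier R" and xy: "x \<otimes>\<^bsub>R\<^esub> y = \<zero>\<^bsub>R\<^esub>"
  shows "y = \<zero>\<^bsub>R\<^esub>"
proof (rule ccontr)
  assume "y \<noteq> \<zero>\<^bsub>R\<^esub>"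
  then have "supp (x \<otimes>\<^bsub>R\<^esub> y) \<noteq> {}"
    using center_mult_two_unique_degrees[OF tf x y] by blast
  then show False using supp_eq_empty_iff[of "x \<otimes>\<^bsub>R\<^esub> y"] xy by simp
qed

text \<open>
  The element \<open>u v = \<one>\<close> occupies only one degree, so that the two surviving extreme degrees of the product
  coincide.
\<close>

lemma central_unit_homogeneous:
  assumes tf: "torsion_free G" and u: "u \<in> ring_center R" "u \<in> Units R"
  shows "homogeneous G R S u"
proof -
  have uR: "u \<in> carrier R" using u(2) by (rule R.Units_closed)
  obtain v where v: "v \<in> carrier R" "u \<otimes>\<^bsub>R\<^esub> v = \<one>\<^bsub>R\<^esub>"
    using u(2) by (auto simp: Units_def)
  have nz: "u \<noteq> \<zero>\<^bsub>R\<^esub>" "v \<noteq> \<zero>\<^bsub>R\<^esub>" using v uR one_nonzero by auto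
  have "supp (u \<otimes>\<^bsub>R\<^esub> v) \<subseteq> {\<one>\<^bsub>G\<^esub>}"
    unfolding v(2) using hcomp_homogeneous[OF G.one_closed one_in_component_one]
    by (auto simp: supp_def split: if_splits)
  then obtain a where a: "supp u = {a}"
    using center_mult_two_unique_degrees[OF tf u(1) nz(1) v(1) nz(2)] by blast
  then have "a \<in> carrier G" using supp_subset by blast
  then show ?thesis
    using nz(1) supp_singleton_mem[OF uR a] unfolding homogeneous_def by blast
qed

lemma central_idempotent_trivial:
  assumes tf: "torsion_free G" and p: "p \<in> ring_center R" "p \<otimes>\<^bsub>R\<^esub> p = p"
  shows "p = \<zero>\<^bsub>R\<^esub> \<or> p = \<one>\<^bsub>R\<^esub>"
proof (rule disjCI)
  assume "p \<noteq> \<one>\<^bsub>R\<^esub>"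
  have pR: "p \<in> carrier R" using p(1) by (simp add: ring_center_def)
  have "p \<otimes>\<^bsub>R\<^esub> (\<one>\<^bsub>R\<^esub> \<ominus>\<^bsub>R\<^esub> p) = \<zero>\<^bsub>R\<^esub>"
    using pR p(2) by (simp add: R.minus_eq R.r_distr R.r_minus R.r_neg)
  moreover have "\<one>\<^bsub>R\<^esub> \<ominus>\<^bsub>R\<^esub> p \<noteq> \<zero>\<^bsub>R\<^esub>" using \<open>p \<noteq> \<one>\<^bsub>R\<^esub>\<close> pR R.r_right_minus_eq by auto
  ultimately show "p = \<zero>\<^bsub>R\<^esub>" using center_regular[OF tf p(1)] pR R.minus_closed R.one_closed by blast
qed

end

theorem theorem6p2:
  fixes G :: "('g, 'm) monoid_scheme" and R :: "('r, 'n) ring_scheme" and S :: "'g \<Rightarrow> 'r set"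
  assumes "graded_ring G R S"
    and "torsion_free G"
    and "nondegenerate_grading G R S"
    and "noncomm_domain (R\<lparr>carrier := S \<one>\<^bsub>G\<^esub>\<rparr>)"
  shows "(\<forall>u \<in> ring_center R \<inter> Units R. homogeneous G R S u) \<and>
         (\<forall>x \<in> ring_center R. \<forall>y \<in> carrier R.
            x \<noteq> \<zero>\<^bsub>R\<^esub> \<longrightarrow> x \<otimes>\<^bsub>R\<^esub> y = \<zero>\<^bsub>R\<^esub> \<longrightarrow> y = \<zero>\<^bsub>R\<^esub>) \<and>
         (\<forall>p \<in> ring_center R. p \<otimes>\<^bsub>R\<^esub> p = p \<longrightarrow> p = \<zero>\<^bsub>R\<^esub> \<or> p = \<one>\<^bsub>R\<^esub>)"
proof -
  interpret nondegenerate_domain_graded_ring G R S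
    using assms(1,3,4)
    by (simp add: nondegenerate_domain_graded_ring_def nondegenerate_domain_graded_ring_axioms_def)
  show ?thesis
    using central_unit_homogeneous[OF assms(2)] center_regular[OF assms(2)]
      central_idempotent_trivial[OF assms(2)]
    by blast
qed

end
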